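(* Let $a,b>0$ and $\gamma=-\frac{ab}{a+b}$ (so that $\gamma\in(-b,0)$). Let $\hat p_4$ be a real polynomial of degree $4$ for which there is a real polynomial $\hat q_2$ of degree $2$ with $$\hat p_4^2(s)-s\left(s-\frac1a\right)\left(s+\frac1b\right)\left(s-\frac1\gamma\right)\hat q_2^2(s)=1.$$ Then $\hat p_4(s)$ equals, up to a constant multiplier, $$T_2\left(\frac{2a^2bs^2+2a^2s-(a+b)}{a+b}\right),$$ where $T_2(x)=2x^2-1$ is the second Chebyshev polynomial.
   Context: The value of $\gamma$ is the one in $(-b,0)$ for which billiard trajectories within the ellipse $\frac{x^2}{a}+\frac{y^2}{b}=1$ in the Minkowski plane with caustic $\frac{x^2}{a-\gamma}+\frac{y^2}{b+\gamma}=1$ (an ellipse) are $4$-periodic. *)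

theory Defs
  imports Complex_Main "HOL-Computational_Algebra.Polynomial"
begin

text \<open>Chebyshev polynomials of the first kind: \<open>T\<^sub>n (cos t) = cos (n t)\<close>.\<close>

fun chebyshev_T :: "nat \<Rightarrow> real poly" where
  "chebyshev_T 0 = 1"
| "chebyshev_T (Suc 0) = [:0, 1:]"
| "chebyshev_T (Suc (Suc n)) = smult 2 ([:0, 1:] * chebyshev_T (Suc n)) - chebyshev_T n"

lemma poly_chebyshev_T_2: "poly (chebyshev_T 2) x = 2 * x\<^sup>2 - 1"
  by (simp add: numeral_2_eq_2 power2_eq_square)

lemma caustic_parameter_in_range:
  fixes a b :: real
  assumes "a > 0" and "b > 0"
  shows "- (a * b) / (a + b) \<in> {-b<..<0}"
  using assms by (simp add: field_simps)

end

theory Submission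
  imports Defs
begin

text \<open>The four roots \<open>0\<close>, \<open>-1/b\<close>, \<open>1/a\<close>, \<open>1/\<gamma> = -1/a - 1/b\<close> are symmetric about \<open>-1/(2b)\<close>, so
  with \<open>k = (a + b) / (a\<^sup>2 b)\<close> and \<open>y = 2 s (s + 1/b) / k - 1\<close> the quartic is \<open>(k/2)\<^sup>2 (y\<^sup>2 - 1)\<close>.
  Hence \<open>T\<^sub>2(y)\<close> together with \<open>(4/k) y\<close> solves the polynomial Pell equation, by
  \<open>T\<^sub>2(y)\<^sup>2 - (y\<^sup>2 - 1) (2 y)\<^sup>2 = 1\<close>, and solutions of a Pell equation in given degrees are unique
  up to sign. In particular the constant multiplier is \<open>1\<close> or \<open>-1\<close>.\<close>

lemma pell_poly_unique_up_to_sign: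
  fixes p q P Q D :: "'a :: {idom, ring_char_0} poly"
  assumes pell: "p\<^sup>2 - D * q\<^sup>2 = 1" and Pell: "P\<^sup>2 - D * Q\<^sup>2 = 1"
    and "Q \<noteq> 0" and "degree q \<le> degree Q" and "degree Q < degree p"
  shows "p = P \<or> p = - P"
proof -
  \<comment> \<open>With \<open>w\<close> a square root of \<open>D\<close>, \<open>?f\<close> and
    \<open>- ?g\<close> are the \<open>w\<close>-coefficients of the product and the quotient of the
    units \<open>p + q * w\<close> and \<open>P + Q * w\<close>.\<close>
  let ?f = "p * Q + q * P" and ?g = "p * Q - q * P"
  have prod: "?f * ?g = Q\<^sup>2 - q\<^sup>2"
  proof -
    have "?f * ?g = p\<^sup>2 * Q\<^sup>2 - q\<^sup>2 * P\<^sup>2"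
      by (simp add: algebra_simps power2_eq_square)
    also have "p\<^sup>2 = 1 + D * q\<^sup>2" using pell by (simp add: algebra_simps)
    also have "P\<^sup>2 = 1 + D * Q\<^sup>2" using Pell by (simp add: algebra_simps)
    finally show ?thesis by (simp add: algebra_simps)
  qed
  have small: "degree (Q\<^sup>2 - q\<^sup>2) \<le> 2 * degree Q"
    using assms(4) by (intro degree_diff_le) (auto simp: power2_eq_square degree_mult_eq_0
      intro!: order.trans[OF degree_mult_le])
  have "p \<noteq> 0" using assms(5) by auto
  have "?f * ?g = 0"
  proof (rule ccontr)
    assume nz: "?f * ?g \<noteq> 0"
    \<comment> \<open>The two factors sum to \<open>2 p Q\<close>, so one of them is too large for their product.\<close>
    have "degree (smult 2 (p * Q)) = degree p + degree Q"
      using \<open>p \<noteq> 0\<close> \<open>Q \<noteq> 0\<close> by (simp add: degree_mult_eq)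
    moreover have "smult 2 (p * Q) = ?f + ?g"
      by (simp flip: mult_2 add: numeral_poly mult.commute)
    ultimately have "degree p + degree Q \<le> max (degree ?f) (degree ?g)"
      by (metis degree_add_le_max)
    also have "\<dots> \<le> degree (?f * ?g)"
      using nz by (simp add: degree_mult_eq)
    finally show False using prod small assms(5) by simp
  qed
  hence "Q\<^sup>2 = q\<^sup>2" using prod by simp
  hence "p\<^sup>2 = P\<^sup>2" using pell Pell by (simp add: algebra_simps)
  thus ?thesis by (simp add: power2_eq_iff)
qed

lemma caustic_quartic_eq:
  fixes a b \<gamma> s :: real
  assumes "a > 0" and "b > 0" and "\<gamma> = - (a * b) / (a + b)"
  defines "k \<equiv> (a + b) / (a\<^sup>2 * b)"
    and "y \<equiv> (2 * a\<^sup>2 * b * s\<^sup>2 + 2 * a\<^sup>2 * s - (a + b)) / (a + b)"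
  shows "s * (s - 1 / a) * (s + 1 / b) * (s - 1 / \<gamma>) = (k / 2)\<^sup>2 * (y\<^sup>2 - 1)"
proof -
  \<comment> \<open>The root pairs \<open>0\<close>, \<open>- 1 / b\<close> and
    \<open>1 / a\<close>, \<open>1 / \<gamma>\<close> have the same sum, so their quadratics differ
    by a constant: \<open>k\<close>, the value of \<open>u\<close> at \<open>1 / a\<close>.\<close>
  define u where "u = s * (s + 1 / b)"
  have [simp]: "a \<noteq> 0" "b \<noteq> 0" "a + b \<noteq> 0" using assms(1,2) by auto
  have "k \<noteq> 0" by (simp add: k_def)
  have "2 * a\<^sup>2 * b * s\<^sup>2 + 2 * a\<^sup>2 * s = 2 * a\<^sup>2 * b * u"
    by (simp add: u_def field_simps power2_eq_square)
  hence y: "y = 2 * u / k - 1"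
    by (simp add: y_def k_def diff_divide_distrib mult_ac)
  have "(k / 2)\<^sup>2 * (y\<^sup>2 - 1) = u * (u - k)"
    unfolding y using \<open>k \<noteq> 0\<close> by (simp add: field_simps power2_eq_square)
  also have "u - k = (s - 1 / a) * (s + 1 / a + 1 / b)"
    by (simp add: u_def k_def field_simps power2_eq_square)
  \<comment> \<open>The choice of \<open>\<gamma>\<close> enters here.\<close>
  also have "s + 1 / a + 1 / b = s - 1 / \<gamma>"
    by (simp add: assms(3) field_simps)
  finally show ?thesis by (simp only: u_def mult_ac)
qed

theorem proposition8p7:
  fixes a b \<gamma> :: real and p\<^sub>4 :: "real poly"
  assumes "a > 0" and "b > 0"
    and "\<gamma> = - (a * b) / (a + b)"
    and "degree p\<^sub>4 = 4"
    and "\<exists>q\<^sub>2 :: real poly. degree q\<^sub>2 = 2 \<and>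
           (\<forall>s :: real. (poly p\<^sub>4 s)\<^sup>2
              - s * (s - 1 / a) * (s + 1 / b) * (s - 1 / \<gamma>) * (poly q\<^sub>2 s)\<^sup>2 = 1)"
  shows "\<exists>c :: real. c \<noteq> 0 \<and>
           (\<forall>s :: real. poly p\<^sub>4 s =
              c * poly (chebyshev_T 2) ((2 * a\<^sup>2 * b * s\<^sup>2 + 2 * a\<^sup>2 * s - (a + b)) / (a + b)))"
proof -
  define y where "y s = (2 * a\<^sup>2 * b * s\<^sup>2 + 2 * a\<^sup>2 * s - (a + b)) / (a + b)" for s
  define k where "k = (a + b) / (a\<^sup>2 * b)"
  define Y where "Y = [:- 1, 2 * a\<^sup>2 / (a + b), 2 * a\<^sup>2 * b / (a + b):]"
  define D where "D = [:0, 1:] * [:- (1 / a), 1:] * [:1 / b, 1:] * [:- (1 / \<gamma>), 1:]"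
  define P where "P = pcompose (chebyshev_T 2) Y"
  \<comment> \<open>Since \<open>(k / 2) * (4 / k) = 2\<close>, \<open>D * Q\<^sup>2\<close> takes
    the value \<open>(y\<^sup>2 - 1) * (2 * y)\<^sup>2\<close>.\<close>
  define Q where "Q = smult (4 / k) Y"
  have [simp]: "a \<noteq> 0" "b \<noteq> 0" "a + b \<noteq> 0" using assms(1,2) by auto
  have "k \<noteq> 0" by (simp add: k_def)
  have Y: "poly Y s = y s" for s
    by (simp add: Y_def y_def add_divide_distrib diff_divide_distrib algebra_simps power2_eq_square)
  have D: "poly D s = s * (s - 1 / a) * (s + 1 / b) * (s - 1 / \<gamma>)" for s
    by (simp add: D_def add.commute del: mult_pCons_left mult_pCons_right)
  have D': "poly D s = (k / 2)\<^sup>2 * ((y s)\<^sup>2 - 1)" for s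
    unfolding D k_def y_def using assms(1-3) by (rule caustic_quartic_eq)
  have P: "poly P s = poly (chebyshev_T 2) (y s)" for s
    by (simp add: P_def poly_pcompose Y)
  have Q: "degree Q = 2" using \<open>k \<noteq> 0\<close> by (simp add: Q_def Y_def)
  obtain q where q: "degree q = 2"
    and pq: "\<And>s. (poly p\<^sub>4 s)\<^sup>2 - s * (s - 1 / a) * (s + 1 / b) * (s - 1 / \<gamma>) * (poly q s)\<^sup>2 = 1"
    using assms(5) by blast
  \<comment> \<open>Agreement at all real points lifts the pointwise hypothesis to an identity of
    polynomials.\<close>
  have "p\<^sub>4\<^sup>2 - D * q\<^sup>2 = 1"
    by (intro poly_eq_poly_eq_iff[THEN iffD1] ext) (simp add: D pq)
  moreover have "P\<^sup>2 - D * Q\<^sup>2 = 1"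
  proof (intro poly_eq_poly_eq_iff[THEN iffD1] ext)
    show "poly (P\<^sup>2 - D * Q\<^sup>2) s = poly 1 s" for s
      using \<open>k \<noteq> 0\<close>
      by (simp add: P poly_chebyshev_T_2 D' Q_def Y field_simps power2_eq_square)
  qed
  moreover have "Q \<noteq> 0" using Q by auto
  ultimately have "p\<^sub>4 = P \<or> p\<^sub>4 = - P"
    using q Q assms(4) by (intro pell_poly_unique_up_to_sign[of _ D q _ Q]) auto
  hence "(\<forall>s. poly p\<^sub>4 s = 1 * poly P s) \<or> (\<forall>s. poly p\<^sub>4 s = - 1 * poly P s)"
    by auto
  thus ?thesis
    unfolding P y_def by (metis one_neq_zero neg_equal_0_iff_equal)
qed

end
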